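(* Let $n\ge 1$ and suppose that $F_1,\ldots,F_n$ are $n$ functions in $\mathscr{S}(\mathbb{D}^n)$ with $F_j(\mathbb{D}^n)\subset\mathbb{D}$ such that $$c^*_{\mathbb{D}^n}(u_1,u_2)=\max\{m(F_j(u_1),F_j(u_2)):1\leq j\leq n\}\quad\text{for all } u_1,u_2\in\mathbb{D}^n.$$ Then the set $\{F_1,\ldots,F_n\}$ and the set of coordinate functions $\{z_1,\ldots,z_n\}$ are equal up to composition with automorphisms of $\mathbb{D}$; that is, there are a permutation $\sigma$ of $\{1,\dots,n\}$ and automorphisms $\phi_1,\dots,\phi_n$ of $\mathbb{D}$ such that $F_j(z)=\phi_j(z_{\sigma(j)})$ for all $z=(z_1,\dots,z_n)\in\mathbb{D}^n$ and all $1\le j\le n$.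
   Context: $\mathbb{D}$ is the open unit disc in $\mathbb{C}$ and automorphisms of $\mathbb{D}$ are its biholomorphic self-maps. For a domain $\Omega\subset\mathbb{C}^n$, the Schur class $\mathscr{S}(\Omega)$ is the closed unit ball, for the supremum norm, of the Banach algebra of bounded holomorphic functions $\Omega\to\mathbb{C}$. For $a,b\in\mathbb{D}$ put $m(a,b)=\left|\frac{a-b}{1-a\overline{b}}\right|$. The Carathéodory pseudodistance on $\Omega$ is $$c^*_\Omega(z_1,z_2)=\sup\{m(f(z_1),f(z_2)): f\in\mathscr{S}(\Omega),\ f(\Omega)\subset\mathbb{D}\}.$$ *)

theory Defs
  imports "HOL-Complex_Analysis.Complex_Analysis"
begin

definition polydisc :: "(complex ^ 'n) set"
  where "polydisc = {z. \<forall>i. z $ i \<in> ball 0 1}"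

(* complex ^ 'n carries only a real normed structure, so complex differentiability is
   expressed as Frechet differentiability with a complex-linear derivative. *)
definition holomorphic_several :: "(complex ^ 'n \<Rightarrow> complex) \<Rightarrow> (complex ^ 'n) set \<Rightarrow> bool"
  where "holomorphic_several f \<Omega> \<longleftrightarrow>
    (\<forall>z\<in>\<Omega>. \<exists>L. (f has_derivative L) (at z within \<Omega>) \<and> (\<forall>c v. L (c *s v) = c * L v))"

definition schur_class :: "(complex ^ 'n) set \<Rightarrow> (complex ^ 'n \<Rightarrow> complex) set"
  where "schur_class \<Omega> =
    {f. holomorphic_several f \<Omega> \<and> bounded (f ` \<Omega>) \<and> (SUP z\<in>\<Omega>. norm (f z)) \<le> 1}"

definition mobius_dist :: "complex \<Rightarrow> complex \<Rightarrow> real"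
  where "mobius_dist a b = norm ((a - b) / (1 - a * cnj b))"

definition caratheodory_dist :: "(complex ^ 'n) set \<Rightarrow> complex ^ 'n \<Rightarrow> complex ^ 'n \<Rightarrow> real"
  where "caratheodory_dist \<Omega> z1 z2 =
    (SUP f\<in>{f \<in> schur_class \<Omega>. f ` \<Omega> \<subseteq> ball 0 1}. mobius_dist (f z1) (f z2))"

definition disc_automorphism :: "(complex \<Rightarrow> complex) \<Rightarrow> bool"
  where "disc_automorphism \<phi> \<longleftrightarrow>
    \<phi> holomorphic_on ball 0 1 \<and> bij_betw \<phi> (ball 0 1) (ball 0 1) \<and>
    inv_into (ball 0 1) \<phi> holomorphic_on ball 0 1"

end

theory Submission
  imports Defs
begin

text \<open>
  The polydisc obeys a Schwarz--Pick lemma: a holomorphic map into the disc does not increase the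
  largest coordinate distance (\<open>polydisc_Schwarz_Pick\<close>). Comparing the origin with the point \<open>1/2\<close> on
  the \<open>k\<close>-th coordinate axis, the hypothesis yields some \<open>F j\<close> whose values at these two points are
  at least as far apart as the points, because the \<open>k\<close>-th coordinate function competes in the
  Caratheodory distance. This is equality in the one-variable Schwarz--Pick lemma, so \<open>F j\<close> restricted
  to the \<open>k\<close>-th axis is an automorphism of the disc (\<open>Schwarz_Pick_equality\<close>).

  Being an automorphism on a single axis forces \<open>F j\<close> to depend on the coordinate \<open>k\<close> alone, on the
  whole polydisc (\<open>depends_on_one_coordinate\<close>). The argument is metric. Seen from a point of the axis
  that is far away, only the \<open>k\<close>-th coordinate of \<open>z\<close> contributes to the largest coordinate distance;
  hence \<open>F j z\<close> is no farther from the value at that point than the value at the projection of \<open>z\<close>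
  to the axis is. Since the values on the axis fill the disc isometrically, this comparison holds
  for all points far out in the disc, in every direction, and prolonging a geodesic
  (\<open>exists_point_beyond\<close>) shows that then the two values coincide.

  Thus every \<open>k\<close> has its own \<open>j\<close>: a function cannot depend on \<open>k\<close> alone, injectively, and also on
  another coordinate alone. The index set is finite, so \<open>k \<mapsto> j\<close> is a permutation, and \<open>\<sigma>\<close> is its
  inverse.
\<close>

section \<open>The Moebius distance and the Schwarz--Pick lemma\<close>

lemma mobius_dist_commute: "mobius_dist a b = mobius_dist b a"
proof -
  have "norm (1 - b * cnj a) = norm (cnj (1 - a * cnj b))"
    by (simp add: mult.commute)
  then have "norm (1 - b * cnj a) = norm (1 - a * cnj b)"
    by (simp only: complex_mod_cnj)
  then show ?thesis
    by (simp add: mobius_dist_def norm_divide norm_minus_commute)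
qed

lemma mobius_dist_eq_norm_Moebius: "mobius_dist a b = norm (Moebius_function 0 a b)"
  by (subst mobius_dist_commute) (simp add: mobius_dist_def Moebius_function_simple mult.commute)

lemma mobius_dist_self [simp]: "mobius_dist a a = 0"
  by (simp add: mobius_dist_def)

lemma mobius_dist_zero_left [simp]: "mobius_dist 0 a = norm a"
  by (simp add: mobius_dist_def)

lemma mobius_dist_less_1: "norm a < 1 \<Longrightarrow> norm b < 1 \<Longrightarrow> mobius_dist a b < 1"
  by (simp add: mobius_dist_eq_norm_Moebius Moebius_function_norm_lt_1)

lemma Moebius_function_in_ball:
  "a \<in> ball 0 1 \<Longrightarrow> z \<in> ball 0 1 \<Longrightarrow> Moebius_function 0 a z \<in> ball 0 1"
  by (simp add: Moebius_function_norm_lt_1)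

lemma Moebius_function_inverse:
  assumes "a \<in> ball 0 1" "z \<in> ball 0 1"
  shows "Moebius_function 0 (- a) (Moebius_function 0 a z) = z"
    and "Moebius_function 0 a (Moebius_function 0 (- a) z) = z"
  using assms by (auto intro!: Moebius_function_compose)

lemma disc_automorphismI:
  assumes f: "f holomorphic_on ball 0 1" "\<And>z. z \<in> ball 0 1 \<Longrightarrow> f z \<in> ball 0 1"
    and g: "g holomorphic_on ball 0 1" "\<And>z. z \<in> ball 0 1 \<Longrightarrow> g z \<in> ball 0 1"
    and gf: "\<And>z. z \<in> ball 0 1 \<Longrightarrow> g (f z) = z"
    and fg: "\<And>z. z \<in> ball 0 1 \<Longrightarrow> f (g z) = z"
  shows "disc_automorphism f"
proof -
  have inj: "inj_on f (ball 0 1)"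
    using gf by (rule inj_on_inverseI)
  have "f ` ball 0 1 = ball 0 1"
    using f(2) g(2) fg by (force simp: image_iff)
  then have "bij_betw f (ball 0 1) (ball 0 1)"
    using inj by (simp add: bij_betw_def)
  moreover have "inv_into (ball 0 1) f z = g z" if "z \<in> ball 0 1" for z
    using inj g(2) fg that by (intro inv_into_f_eq) auto
  then have "inv_into (ball 0 1) f holomorphic_on ball 0 1"
    using g(1) by (subst holomorphic_cong[OF refl]) auto
  ultimately show ?thesis
    using f(1) by (simp add: disc_automorphism_def)
qed

text \<open>
  Moving both the base point and its image to the origin by Moebius maps turns a self-map of the
  disc into one that fixes the origin; this is the form to which the Schwarz lemma applies.
\<close>
lemma recentre_self_map:
  assumes f: "f holomorphic_on ball 0 1" "f ` ball 0 1 \<subseteq> ball 0 1"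
    and s: "s \<in> ball 0 1"
  defines "h \<equiv> \<lambda>z. Moebius_function 0 (f s) (f (Moebius_function 0 (- s) z))"
  shows "h holomorphic_on ball 0 1" "h 0 = 0" "\<And>z. norm z < 1 \<Longrightarrow> norm (h z) < 1"
    and "\<And>t. t \<in> ball 0 1 \<Longrightarrow> h (Moebius_function 0 s t) = Moebius_function 0 (f s) (f t)"
proof -
  have s': "- s \<in> ball 0 1"
    using s by simp
  have fs: "f s \<in> ball 0 1"
    using f(2) s by blast
  have fM: "f (Moebius_function 0 (- s) z) \<in> ball 0 1" if "z \<in> ball 0 1" for z
    using f(2) Moebius_function_in_ball[OF s' that] by blast
  have "(f \<circ> Moebius_function 0 (- s)) holomorphic_on ball 0 1"
    using s' Moebius_function_in_ball[OF s']
    by (intro holomorphic_on_compose_gen[OF _ f(1)] Moebius_function_holomorphic) auto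
  then have "(Moebius_function 0 (f s) \<circ> (f \<circ> Moebius_function 0 (- s))) holomorphic_on ball 0 1"
    using fs fM by (intro holomorphic_on_compose_gen[OF _ Moebius_function_holomorphic[of "f s"]]) auto
  then show "h holomorphic_on ball 0 1"
    by (simp add: h_def o_def)
  show "h 0 = 0"
    by (simp add: h_def Moebius_function_of_zero Moebius_function_eq_zero)
  show "norm (h z) < 1" if "norm z < 1" for z
    using Moebius_function_in_ball[OF fs fM[of z]] that by (simp add: h_def)
  show "h (Moebius_function 0 s t) = Moebius_function 0 (f s) (f t)" if "t \<in> ball 0 1" for t
    using Moebius_function_inverse(1)[OF s that] by (simp add: h_def)
qed

lemma Schwarz_Pick:
  assumes f: "f holomorphic_on ball 0 1" "f ` ball 0 1 \<subseteq> ball 0 1"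
    and s: "s \<in> ball 0 1" and t: "t \<in> ball 0 1"
  shows "mobius_dist (f s) (f t) \<le> mobius_dist s t"
proof -
  note h = recentre_self_map[OF f s]
  have "norm (Moebius_function 0 s t) < 1"
    using Moebius_function_in_ball[OF s t] by simp
  from Schwarz_Lemma(1)[OF h(1,2) _ this] h(3) show ?thesis
    unfolding mobius_dist_eq_norm_Moebius h(4)[OF t, symmetric] by blast
qed

text \<open>
  If a single distance is preserved, the recentred map is a rotation by the equality case of the
  Schwarz lemma, so \<open>f\<close> is a composition of automorphisms.
\<close>
lemma Schwarz_Pick_equality:
  assumes f: "f holomorphic_on ball 0 1" "f ` ball 0 1 \<subseteq> ball 0 1"
    and s: "s \<in> ball 0 1" and t: "t \<in> ball 0 1" and "s \<noteq> t"
    and eq: "mobius_dist (f s) (f t) = mobius_dist s t"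
  shows "disc_automorphism f"
proof -
  note h = recentre_self_map[OF f s]
  let ?M = "Moebius_function 0"
  have fs: "f s \<in> ball 0 1"
    using f(2) s by blast
  have s': "- s \<in> ball 0 1"
    using s by simp
  have Mst: "norm (?M s t) < 1"
    using Moebius_function_in_ball[OF s t] by simp
  have "?M s t \<noteq> 0"
    using Moebius_function_inverse(1)[OF s t] \<open>s \<noteq> t\<close> by (auto simp: Moebius_function_of_zero)
  moreover have "norm (?M (f s) (f (?M (- s) (?M s t)))) = norm (?M s t)"
    using eq unfolding mobius_dist_eq_norm_Moebius h(4)[OF t] .
  ultimately obtain \<alpha> where \<alpha>: "\<And>z. norm z < 1 \<Longrightarrow> ?M (f s) (f (?M (- s) z)) = \<alpha> * z"
    and "norm \<alpha> = 1"
    using Schwarz_Lemma(3)[OF h(1,2) _ Mst] h(3) Mst by blast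
  have "\<alpha> \<noteq> 0"
    using \<open>norm \<alpha> = 1\<close> by auto
  have \<alpha>': "?M (f s) (f z) = \<alpha> * ?M s z" if "z \<in> ball 0 1" for z
    using \<alpha>[of "?M s z"] h(4)[OF that] Moebius_function_in_ball[OF s that] by simp
  \<comment> \<open>The inverse comes from solving \<open>\<alpha>'\<close> for \<open>z\<close>.\<close>
  define g where "g = (\<lambda>w. ?M (- s) (?M (f s) w / \<alpha>))"
  have quot: "?M (f s) w / \<alpha> \<in> ball 0 1" if "w \<in> ball 0 1" for w
    using Moebius_function_in_ball[OF fs that] \<open>norm \<alpha> = 1\<close> by (simp add: norm_divide)
  show ?thesis
  proof (rule disc_automorphismI[OF f(1)])
    show "f z \<in> ball 0 1" if "z \<in> ball 0 1" for z
      using f(2) that by blast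
    have "(\<lambda>w. ?M (f s) w / \<alpha>) holomorphic_on ball 0 1"
      using Moebius_function_holomorphic[of "f s" 0] fs \<open>\<alpha> \<noteq> 0\<close>
      by (intro holomorphic_intros) auto
    then have "(Moebius_function 0 (- s) \<circ> (\<lambda>w. ?M (f s) w / \<alpha>)) holomorphic_on ball 0 1"
      using s quot
      by (intro holomorphic_on_compose_gen[OF _ Moebius_function_holomorphic[of "- s"]]) auto
    then show "g holomorphic_on ball 0 1"
      by (simp add: g_def o_def)
    show "g w \<in> ball 0 1" if "w \<in> ball 0 1" for w
      unfolding g_def by (rule Moebius_function_in_ball[OF s' quot[OF that]])
    show "g (f z) = z" if "z \<in> ball 0 1" for z
      using \<alpha>'[OF that] Moebius_function_inverse(1)[OF s that] \<open>\<alpha> \<noteq> 0\<close> by (simp add: g_def)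
    show "f (g w) = w" if "w \<in> ball 0 1" for w
    proof -
      have gw: "g w \<in> ball 0 1"
        unfolding g_def by (rule Moebius_function_in_ball[OF s' quot[OF that]])
      have "?M (f s) (f (g w)) = \<alpha> * ?M s (g w)"
        by (rule \<alpha>'[OF gw])
      also have "\<dots> = ?M (f s) w"
        using Moebius_function_inverse(2)[OF s quot[OF that]] \<open>\<alpha> \<noteq> 0\<close> by (simp add: g_def)
      finally show ?thesis
        using Moebius_function_inverse(1)[OF fs] f(2) gw that by (metis image_subset_iff)
    qed
  qed
qed

lemma disc_automorphismD:
  assumes "disc_automorphism \<phi>"
  defines "\<psi> \<equiv> inv_into (ball 0 1) \<phi>"
  shows "\<And>z. z \<in> ball 0 1 \<Longrightarrow> \<phi> z \<in> ball 0 1" "\<And>w. w \<in> ball 0 1 \<Longrightarrow> \<psi> w \<in> ball 0 1"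
    and "\<And>z. z \<in> ball 0 1 \<Longrightarrow> \<psi> (\<phi> z) = z" "\<And>w. w \<in> ball 0 1 \<Longrightarrow> \<phi> (\<psi> w) = w"
    and "\<phi> holomorphic_on ball 0 1" "\<psi> holomorphic_on ball 0 1"
proof -
  have bij: "bij_betw \<phi> (ball 0 1) (ball 0 1)"
    using assms by (simp add: disc_automorphism_def)
  show "\<phi> z \<in> ball 0 1" if "z \<in> ball 0 1" for z
    using bij that by (rule bij_betw_apply)
  show "\<psi> w \<in> ball 0 1" if "w \<in> ball 0 1" for w
    using bij_betw_apply[OF bij_betw_inv_into[OF bij] that] by (simp add: \<psi>_def)
  show "\<psi> (\<phi> z) = z" if "z \<in> ball 0 1" for z
    using bij_betw_inv_into_left[OF bij that] by (simp add: \<psi>_def)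
  show "\<phi> (\<psi> w) = w" if "w \<in> ball 0 1" for w
    using bij_betw_inv_into_right[OF bij that] by (simp add: \<psi>_def)
  show "\<phi> holomorphic_on ball 0 1" "\<psi> holomorphic_on ball 0 1"
    using assms by (simp_all add: disc_automorphism_def)
qed

text \<open>Neither the automorphism nor its inverse increases distances, by Schwarz--Pick.\<close>
lemma disc_automorphism_isometry:
  assumes "disc_automorphism \<phi>" "s \<in> ball 0 1" "t \<in> ball 0 1"
  shows "mobius_dist (\<phi> s) (\<phi> t) = mobius_dist s t"
proof (rule antisym)
  note \<phi> = disc_automorphismD[OF assms(1)]
  show "mobius_dist (\<phi> s) (\<phi> t) \<le> mobius_dist s t"
    using Schwarz_Pick[OF \<phi>(5) image_subsetI assms(2,3)] \<phi>(1) by blast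
  show "mobius_dist s t \<le> mobius_dist (\<phi> s) (\<phi> t)"
    using Schwarz_Pick[OF \<phi>(6) image_subsetI \<phi>(1)[OF assms(2)] \<phi>(1)[OF assms(3)]] \<phi>(2)
      \<phi>(3)[OF assms(2)] \<phi>(3)[OF assms(3)] by simp
qed

lemma disc_automorphism_Moebius:
  assumes "a \<in> ball 0 1"
  shows "disc_automorphism (Moebius_function 0 a)"
proof (rule disc_automorphismI)
  have a': "- a \<in> ball 0 1"
    using assms by simp
  show "Moebius_function 0 a holomorphic_on ball 0 1"
    "Moebius_function 0 (- a) holomorphic_on ball 0 1"
    using assms by (simp_all add: Moebius_function_holomorphic)
  show "Moebius_function 0 a z \<in> ball 0 1" "Moebius_function 0 (- a) z \<in> ball 0 1"
    if "z \<in> ball 0 1" for z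
    using Moebius_function_in_ball[OF assms that] Moebius_function_in_ball[OF a' that] by auto
  show "Moebius_function 0 (- a) (Moebius_function 0 a z) = z"
    "Moebius_function 0 a (Moebius_function 0 (- a) z) = z" if "z \<in> ball 0 1" for z
    using Moebius_function_inverse[OF assms that] by auto
qed

text \<open>
  The hyperbolic geodesic from \<open>w\<close> to \<open>a\<close> can be prolonged beyond \<open>a\<close> as far as one wishes, and
  along the prolongation distances from \<open>w\<close> are larger than distances from \<open>a\<close>. After \<open>a\<close> has been
  moved to the origin the geodesic is a diameter, and the point is written down explicitly.
\<close>
lemma exists_point_beyond:
  assumes a: "a \<in> ball 0 1" and w: "w \<in> ball 0 1" and "w \<noteq> a" and "r < 1"
  shows "\<exists>s \<in> ball 0 1. r \<le> mobius_dist a s \<and> mobius_dist a s < mobius_dist w s"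
proof -
  let ?M = "Moebius_function 0 a"
  have a': "- a \<in> ball 0 1"
    using a by simp
  define v where "v = ?M w"
  have v: "v \<in> ball 0 1"
    unfolding v_def by (rule Moebius_function_in_ball[OF a w])
  have "v \<noteq> 0"
    using Moebius_function_inverse(1)[OF a w] \<open>w \<noteq> a\<close>
    by (auto simp: v_def Moebius_function_of_zero)
  then have nv: "0 < norm v" "norm v < 1"
    using v by auto
  define t where "t = max 0 r"
  have t: "0 \<le> t" "t < 1" "r \<le> t"
    using \<open>r < 1\<close> by (auto simp: t_def)
  define \<tau> where "\<tau> = - complex_of_real t * sgn v"
  have norm_\<tau>: "norm \<tau> = t"
    using t \<open>v \<noteq> 0\<close> by (simp add: \<tau>_def norm_mult norm_sgn)
  then have \<tau>: "\<tau> \<in> ball 0 1"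
    using t by simp
  \<comment> \<open>On the diameter the distance is given by hyperbolic addition of the two radii.\<close>
  have "mobius_dist v \<tau> = (norm v + t) / (1 + t * norm v)"
  proof -
    have v_polar: "v = complex_of_real (norm v) * sgn v"
      using \<open>v \<noteq> 0\<close> by (simp add: sgn_eq)
    have unit: "sgn v * cnj (sgn v) = 1"
      using complex_norm_square[of "sgn v"] \<open>v \<noteq> 0\<close> by (simp add: norm_sgn)
    have "v - \<tau> = complex_of_real (norm v + t) * sgn v"
      by (subst v_polar) (simp add: \<tau>_def distrib_right)
    then have "norm (v - \<tau>) = \<bar>norm v + t\<bar> * norm (sgn v)"
      by (simp only: norm_mult norm_of_real)
    then have 1: "norm (v - \<tau>) = norm v + t"
      using t nv \<open>v \<noteq> 0\<close> by (simp add: norm_sgn)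
    have "v * cnj \<tau> = - complex_of_real (t * norm v) * (sgn v * cnj (sgn v))"
      by (subst v_polar) (simp add: \<tau>_def mult_ac)
    then have "1 - v * cnj \<tau> = complex_of_real (1 + t * norm v)"
      by (simp add: unit)
    then have "norm (1 - v * cnj \<tau>) = \<bar>1 + t * norm v\<bar>"
      by (simp only: norm_of_real)
    then have 2: "norm (1 - v * cnj \<tau>) = 1 + t * norm v"
      using t nv by simp
    show ?thesis
      using 1 2 by (simp add: mobius_dist_def norm_divide)
  qed
  moreover have "t < (norm v + t) / (1 + t * norm v)"
  proof -
    have pos: "0 < 1 + t * norm v"
      using t nv by (intro add_pos_nonneg) auto
    have "t * t \<le> t * 1"
      using t by (intro mult_left_mono) auto
    then have "t * t < 1"
      using t by simp
    then have "norm v * (t * t) < norm v * 1"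
      using nv by (intro mult_strict_left_mono) auto
    then show ?thesis
      unfolding pos_less_divide_eq[OF pos] by (simp add: algebra_simps)
  qed
  ultimately have less: "norm \<tau> < mobius_dist v \<tau>"
    by (simp add: norm_\<tau>)
  define s where "s = Moebius_function 0 (- a) \<tau>"
  have s: "s \<in> ball 0 1"
    unfolding s_def by (rule Moebius_function_in_ball[OF a' \<tau>])
  have Ms: "?M s = \<tau>"
    unfolding s_def by (rule Moebius_function_inverse(2)[OF a \<tau>])
  have as: "mobius_dist a s = norm \<tau>"
    by (simp add: mobius_dist_eq_norm_Moebius Ms)
  have "mobius_dist w s = mobius_dist v \<tau>"
    using disc_automorphism_isometry[OF disc_automorphism_Moebius[OF a] w s] by (simp add: v_def Ms)
  then show ?thesis
    using as less s t(3) norm_\<tau> by (intro bexI[of _ s]) auto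
qed

section \<open>Holomorphic functions on the polydisc\<close>

lemma has_derivative_componentwise_vec:
  fixes \<gamma> :: "'n::finite \<Rightarrow> 'a::real_normed_vector \<Rightarrow> 'b::real_normed_vector"
  assumes "\<And>i. (\<gamma> i has_derivative \<gamma>' i) (at x within S)"
  shows "((\<lambda>z. \<chi> i. \<gamma> i z) has_derivative (\<lambda>h. \<chi> i. \<gamma>' i h)) (at x within S)"
proof (rule has_derivativeI)
  have lin: "bounded_linear (\<gamma>' i)" for i
    using assms by (rule has_derivative_bounded_linear)
  show "bounded_linear (\<lambda>h. \<chi> i. \<gamma>' i h)"
  proof (rule bounded_linear_intro[where K = "\<Sum>i\<in>UNIV. onorm (\<gamma>' i)"])
    show "norm (\<chi> i. \<gamma>' i h) \<le> norm h * (\<Sum>i\<in>UNIV. onorm (\<gamma>' i))" for h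
    proof -
      have "norm (\<chi> i. \<gamma>' i h) \<le> (\<Sum>i\<in>UNIV. norm (\<gamma>' i h))"
        using L2_set_le_sum[of UNIV "\<lambda>i. norm (\<gamma>' i h)"] by (simp add: norm_vec_def)
      also have "\<dots> \<le> (\<Sum>i\<in>UNIV. onorm (\<gamma>' i) * norm h)"
        by (intro sum_mono onorm lin)
      finally show ?thesis
        by (simp add: sum_distrib_left mult.commute)
    qed
  qed (simp_all add: vec_eq_iff linear_add[OF bounded_linear.linear[OF lin]]
      linear_scale[OF bounded_linear.linear[OF lin]])
  have lim: "((\<lambda>y. (\<gamma> i y - \<gamma> i x - \<gamma>' i (y - x)) /\<^sub>R norm (y - x)) \<longlongrightarrow> 0) (at x within S)" for i
    using assms[of i] by (simp add: has_derivative_at_within)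
  show "((\<lambda>y. ((\<chi> i. \<gamma> i y) - (\<chi> i. \<gamma> i x) - (\<chi> i. \<gamma>' i (y - x))) /\<^sub>R norm (y - x)) \<longlongrightarrow> 0)
    (at x within S)"
    by (rule vec_tendstoI) (use lim in simp)
qed

text \<open>
  The derivative of a curve with holomorphic components has the form \<open>h \<mapsto> h *s d\<close>, so the
  complex-linearity demanded of the derivative of \<open>f\<close> is what makes the composite holomorphic.
\<close>
lemma holomorphic_several_compose:
  fixes f :: "complex ^ 'n::finite \<Rightarrow> complex"
  assumes f: "holomorphic_several f \<Omega>"
    and \<gamma>: "\<And>i. \<gamma> i holomorphic_on S"
    and sub: "\<And>z. z \<in> S \<Longrightarrow> (\<chi> i. \<gamma> i z) \<in> \<Omega>"
  shows "(\<lambda>z. f (\<chi> i. \<gamma> i z)) holomorphic_on S"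
  unfolding holomorphic_on_def
proof
  fix z assume z: "z \<in> S"
  let ?c = "\<lambda>z. \<chi> i. \<gamma> i z"
  have "\<forall>i. \<exists>d. (\<gamma> i has_field_derivative d) (at z within S)"
    using \<gamma> z by (auto simp: holomorphic_on_def field_differentiable_def)
  then obtain d where d: "\<And>i. (\<gamma> i has_field_derivative d i) (at z within S)"
    by metis
  have c: "(?c has_derivative (\<lambda>h. \<chi> i. d i * h)) (at z within S)"
    by (rule has_derivative_componentwise_vec) (rule d[unfolded has_field_derivative_def])
  obtain L where L: "(f has_derivative L) (at (?c z) within \<Omega>)" "\<And>k v. L (k *s v) = k * L v"
    using f sub[OF z] unfolding holomorphic_several_def by metis
  have "(f has_derivative L) (at (?c z) within ?c ` S)"
    using L(1) sub by (rule has_derivative_subset[OF _ image_subsetI])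
  from diff_chain_within[OF c this]
  have "((\<lambda>z. f (?c z)) has_derivative (\<lambda>h. L (\<chi> i. d i * h))) (at z within S)"
    by (simp add: o_def)
  moreover have "L (\<chi> i. d i * h) = L (\<chi> i. d i) * h" for h
  proof -
    have "(\<chi> i. d i * h) = h *s (\<chi> i. d i)"
      by (simp add: vec_eq_iff mult.commute)
    then show ?thesis
      by (simp only: L(2) mult.commute)
  qed
  ultimately show "(\<lambda>z. f (?c z)) field_differentiable at z within S"
    unfolding field_differentiable_def has_field_derivative_def by auto
qed

text \<open>
  Any two points of the polydisc lie on an analytic disc that sends the origin to the first point
  and a given \<open>r\<close> to the second, as soon as \<open>r\<close> dominates all coordinate distances: in each
  coordinate one uses a rotation and contraction followed by a Moebius map. Restricting \<open>f\<close> to this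
  disc reduces the claim to one variable.
\<close>
lemma polydisc_Schwarz_Pick:
  fixes f :: "complex ^ 'n::finite \<Rightarrow> complex" and u v :: "complex ^ 'n"
  assumes f: "holomorphic_several f polydisc" "f ` polydisc \<subseteq> ball 0 1"
    and u: "u \<in> polydisc" and v: "v \<in> polydisc"
    and r: "\<And>i. mobius_dist (u $ i) (v $ i) \<le> r" and "r < 1"
  shows "mobius_dist (f u) (f v) \<le> r"
proof -
  let ?M = "Moebius_function 0"
  have ui: "u $ i \<in> ball 0 1" and vi: "v $ i \<in> ball 0 1" for i
    using u v by (auto simp: polydisc_def)
  have ui': "- u $ i \<in> ball 0 1" for i
    using ui[of i] by simp
  have rM: "norm (?M (u $ i) (v $ i)) \<le> r" for i
    using r by (simp add: mobius_dist_eq_norm_Moebius)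
  then have "0 \<le> r"
    using norm_ge_zero order_trans by blast
  \<comment> \<open>If \<open>r = 0\<close> then \<open>u = v\<close>, and division by zero makes the disc below constant, as it should be.\<close>
  define q where "q = (\<lambda>i. ?M (u $ i) (v $ i) / of_real r)"
  have q: "norm (q i) \<le> 1" for i
    using rM[of i] \<open>0 \<le> r\<close> by (cases "r = 0") (auto simp: q_def norm_divide)
  have qr: "q i * of_real r = ?M (u $ i) (v $ i)" for i
    using rM[of i] by (cases "r = 0") (auto simp: q_def)
  have qz: "q i * z \<in> ball 0 1" if "z \<in> ball 0 1" for i z
  proof -
    have "norm (q i) * norm z \<le> 1 * norm z"
      using q by (intro mult_right_mono) auto
    then show ?thesis
      using that by (simp add: norm_mult)
  qed
  define \<gamma> where "\<gamma> = (\<lambda>i z. ?M (- u $ i) (q i * z))"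
  have "(?M (- u $ i) \<circ> (\<lambda>z. q i * z)) holomorphic_on ball 0 1" for i
    using ui'[of i] qz
    by (intro holomorphic_on_compose_gen[OF _ Moebius_function_holomorphic[of "- u $ i"]]
        holomorphic_intros) auto
  then have hol: "\<gamma> i holomorphic_on ball 0 1" for i
    by (simp add: \<gamma>_def o_def)
  have in_poly: "(\<chi> i. \<gamma> i z) \<in> polydisc" if "z \<in> ball 0 1" for z
    using Moebius_function_in_ball[OF ui' qz[OF that]] by (simp add: polydisc_def \<gamma>_def)
  have \<gamma>0: "(\<chi> i. \<gamma> i 0) = u"
    by (simp add: vec_eq_iff \<gamma>_def Moebius_function_of_zero)
  have \<gamma>r: "(\<chi> i. \<gamma> i (of_real r)) = v"
    using Moebius_function_inverse(1)[OF ui vi] by (simp add: vec_eq_iff \<gamma>_def qr)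
  have "mobius_dist (f (\<chi> i. \<gamma> i 0)) (f (\<chi> i. \<gamma> i (of_real r))) \<le> mobius_dist 0 (of_real r)"
  proof (rule Schwarz_Pick)
    show "(\<lambda>z. f (\<chi> i. \<gamma> i z)) holomorphic_on ball 0 1"
      using hol in_poly by (rule holomorphic_several_compose[OF f(1)])
    show "(\<lambda>z. f (\<chi> i. \<gamma> i z)) ` ball 0 1 \<subseteq> ball 0 1"
      using in_poly f(2) by blast
  qed (use \<open>0 \<le> r\<close> \<open>r < 1\<close> in auto)
  then show ?thesis
    using \<open>0 \<le> r\<close> unfolding \<gamma>0 \<gamma>r by simp
qed

lemma axis_in_polydisc: "s \<in> ball 0 1 \<Longrightarrow> axis k s \<in> polydisc"
  by (simp add: polydisc_def axis_def)

lemma holomorphic_on_axis: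
  fixes f :: "complex ^ 'n::finite \<Rightarrow> complex"
  assumes "holomorphic_several f polydisc"
  shows "(\<lambda>s. f (axis k s)) holomorphic_on ball 0 1"
proof -
  have axis: "axis k s = (\<chi> i. if i = k then s else 0)" for s :: complex
    by (simp add: axis_def)
  have "(\<lambda>s. f (\<chi> i. if i = k then s else 0)) holomorphic_on ball 0 1"
  proof (rule holomorphic_several_compose[OF assms])
    show "(\<lambda>s. if i = k then s else 0) holomorphic_on ball 0 1" for i
      by (cases "i = k") auto
    show "(\<chi> i. if i = k then s else 0) \<in> polydisc" if "s \<in> ball 0 1" for s
      using that by (simp add: polydisc_def)
  qed
  then show ?thesis
    by (simp add: axis)
qed

text \<open>
  Suppose that \<open>w = f z\<close> differs from the value \<open>a\<close> of \<open>f\<close> at the projection of \<open>z\<close> to the axis.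
  Prolong the geodesic from \<open>w\<close> through \<open>a\<close> to a point \<open>p\<close> whose distance from \<open>a\<close> is at least
  the modulus of every coordinate of \<open>z\<close>. Since \<open>f\<close> is a surjective isometry on the axis, \<open>p\<close> is the value
  at an axis point whose distance from \<open>z\<close> is governed by coordinate \<open>k\<close> alone and equals the
  distance from \<open>a\<close> to \<open>p\<close>. So \<open>f\<close> would have to increase a distance.
\<close>
lemma depends_on_one_coordinate:
  fixes f :: "complex ^ 'n::finite \<Rightarrow> complex"
  assumes f: "holomorphic_several f polydisc" "f ` polydisc \<subseteq> ball 0 1"
    and aut: "disc_automorphism (\<lambda>s. f (axis k s))"
    and z: "z \<in> polydisc"
  shows "f z = f (axis k (z $ k))"
proof (rule ccontr)
  let ?\<phi> = "\<lambda>s. f (axis k s)"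
  note \<phi> = disc_automorphismD[OF aut]
  let ?a = "?\<phi> (z $ k)"
  assume "f z \<noteq> ?a"
  have zi: "z $ i \<in> ball 0 1" for i
    using z by (simp add: polydisc_def)
  define r where "r = Max (range (\<lambda>i. norm (z $ i)))"
  have r: "norm (z $ i) \<le> r" for i
    by (simp add: r_def)
  have "r < 1"
    using zi by (simp add: r_def)
  have fz: "f z \<in> ball 0 1"
    using f(2) z by blast
  from exists_point_beyond[OF \<phi>(1)[OF zi] fz \<open>f z \<noteq> ?a\<close> \<open>r < 1\<close>]
  obtain p where p: "p \<in> ball 0 1" "r \<le> mobius_dist ?a p" "mobius_dist ?a p < mobius_dist (f z) p"
    by blast
  define s where "s = inv_into (ball 0 1) ?\<phi> p"
  have s: "s \<in> ball 0 1" and \<phi>s: "?\<phi> s = p"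
    using \<phi>(2,4)[OF p(1)] by (simp_all add: s_def)
  have dist: "mobius_dist (z $ k) s = mobius_dist ?a p"
    using disc_automorphism_isometry[OF aut zi s] by (simp add: \<phi>s)
  have "mobius_dist (f z) (f (axis k s)) \<le> mobius_dist ?a p"
  proof (rule polydisc_Schwarz_Pick[OF f z axis_in_polydisc[OF s]])
    show "mobius_dist (z $ i) (axis k s $ i) \<le> mobius_dist ?a p" for i
    proof (cases "i = k")
      case True
      then show ?thesis
        by (simp add: dist)
    next
      case False
      then have "mobius_dist (z $ i) (axis k s $ i) = norm (z $ i)"
        by (simp add: axis_def mobius_dist_commute[of _ 0])
      then show ?thesis
        using r[of i] p(2) by simp
    qed
    show "mobius_dist ?a p < 1"
      using \<phi>(1)[OF zi] p(1) by (simp add: mobius_dist_less_1)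
  qed
  then show False
    using p(3) by (simp add: \<phi>s)
qed

section \<open>Families that realise the Caratheodory distance\<close>

lemma zero_in_polydisc: "0 \<in> polydisc"
  by (simp add: polydisc_def)

lemma coordinate_in_schur_class:
  "(\<lambda>z. z $ k) \<in> schur_class (polydisc :: (complex ^ 'n::finite) set)"
proof -
  have "holomorphic_several (\<lambda>z :: complex ^ 'n. z $ k) polydisc"
    unfolding holomorphic_several_def
    by (auto intro!: exI[of _ "\<lambda>z. z $ k"] bounded_linear_imp_has_derivative bounded_linear_vec_nth)
  moreover have le: "norm (z $ k) \<le> 1" if "z \<in> polydisc" for z :: "complex ^ 'n"
    using that by (auto simp: polydisc_def less_imp_le)
  then have "bounded ((\<lambda>z :: complex ^ 'n. z $ k) ` polydisc)"
    by (auto intro!: boundedI[of _ 1])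
  moreover have "(SUP z\<in>polydisc :: (complex ^ 'n) set. norm (z $ k)) \<le> 1"
    using zero_in_polydisc le by (intro cSUP_least) auto
  ultimately show ?thesis
    by (simp add: schur_class_def)
qed

lemma mobius_dist_le_caratheodory_dist:
  assumes "f \<in> schur_class \<Omega>" "f ` \<Omega> \<subseteq> ball 0 1" "u \<in> \<Omega>" "v \<in> \<Omega>"
  shows "mobius_dist (f u) (f v) \<le> caratheodory_dist \<Omega> u v"
  unfolding caratheodory_dist_def
proof (rule cSUP_upper)
  show "bdd_above ((\<lambda>f. mobius_dist (f u) (f v)) ` {f \<in> schur_class \<Omega>. f ` \<Omega> \<subseteq> ball 0 1})"
  proof (rule bdd_aboveI2)
    fix g assume "g \<in> {f \<in> schur_class \<Omega>. f ` \<Omega> \<subseteq> ball 0 1}"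
    then have "norm (g u) < 1" "norm (g v) < 1"
      using assms(3,4) by auto
    then show "mobius_dist (g u) (g v) \<le> 1"
      using mobius_dist_less_1 less_imp_le by blast
  qed
qed (use assms in auto)

theorem lemma2p6:
  fixes F :: "'n::finite \<Rightarrow> complex ^ 'n \<Rightarrow> complex"
  assumes "\<And>j. F j \<in> schur_class polydisc"
    and "\<And>j. F j ` polydisc \<subseteq> ball 0 1"
    and "\<And>u1 u2. u1 \<in> polydisc \<Longrightarrow> u2 \<in> polydisc \<Longrightarrow>
      caratheodory_dist polydisc u1 u2 = Max (range (\<lambda>j. mobius_dist (F j u1) (F j u2)))"
  shows "\<exists>(\<sigma> :: 'n \<Rightarrow> 'n) (\<phi> :: 'n \<Rightarrow> complex \<Rightarrow> complex).
    \<sigma> permutes UNIV \<and> (\<forall>j. disc_automorphism (\<phi> j)) \<and>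
    (\<forall>j. \<forall>z\<in>polydisc. F j z = \<phi> j (z $ \<sigma> j))"
proof -
  have hol: "holomorphic_several (F j) polydisc" for j
    using assms(1) by (simp add: schur_class_def)
  have half: "(1/2 :: complex) \<in> ball 0 1"
    by simp
  have "\<exists>j. disc_automorphism (\<lambda>s. F j (axis k s))" for k
  proof -
    let ?u = "axis k 0 :: complex ^ 'n" and ?v = "axis k (1/2) :: complex ^ 'n"
    have u: "?u \<in> polydisc" and v: "?v \<in> polydisc"
      using half by (intro axis_in_polydisc; simp)+
    have "caratheodory_dist polydisc ?u ?v \<in> range (\<lambda>j. mobius_dist (F j ?u) (F j ?v))"
      unfolding assms(3)[OF u v] by (rule Max_in) auto
    then obtain j where "caratheodory_dist polydisc ?u ?v = mobius_dist (F j ?u) (F j ?v)"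
      by blast
    moreover have "mobius_dist 0 (1/2) \<le> caratheodory_dist polydisc ?u ?v"
    proof -
      have "(\<lambda>z :: complex ^ 'n. z $ k) ` polydisc \<subseteq> ball 0 1"
        by (auto simp: polydisc_def)
      from mobius_dist_le_caratheodory_dist[OF coordinate_in_schur_class this u v]
      show ?thesis
        by simp
    qed
    ultimately have ge: "mobius_dist 0 (1/2) \<le> mobius_dist (F j ?u) (F j ?v)"
      by simp
    have slice: "(\<lambda>s. F j (axis k s)) holomorphic_on ball 0 1"
      "(\<lambda>s. F j (axis k s)) ` ball 0 1 \<subseteq> ball 0 1"
      using holomorphic_on_axis[OF hol] assms(2) axis_in_polydisc by (blast, blast)
    have "mobius_dist (F j ?u) (F j ?v) \<le> mobius_dist 0 (1/2)"
      using Schwarz_Pick[OF slice _ half, of 0] by simp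
    with ge have "disc_automorphism (\<lambda>s. F j (axis k s))"
      by (intro Schwarz_Pick_equality[OF slice _ half, of 0]) auto
    then show ?thesis ..
  qed
  then obtain \<tau> where \<tau>: "\<And>k. disc_automorphism (\<lambda>s. F (\<tau> k) (axis k s))"
    by metis
  have F_\<tau>: "F (\<tau> k) z = F (\<tau> k) (axis k (z $ k))" if "z \<in> polydisc" for k z
    using depends_on_one_coordinate[OF hol assms(2) \<tau> that] .
  \<comment> \<open>A function that depends on coordinate \<open>l\<close> alone is constant on every other coordinate axis.\<close>
  have "inj \<tau>"
  proof (rule injI, rule ccontr)
    fix k l assume "\<tau> k = \<tau> l" "k \<noteq> l"
    then have "F (\<tau> k) (axis k (1/2)) = F (\<tau> k) (axis l 0)"
      using F_\<tau>[OF axis_in_polydisc[OF half], of l k] by (simp add: axis_def)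
    also have "\<dots> = F (\<tau> k) (axis k 0)"
      using F_\<tau>[OF zero_in_polydisc, of k] F_\<tau>[OF zero_in_polydisc, of l] \<open>\<tau> k = \<tau> l\<close> by simp
    finally have "mobius_dist 0 (1/2) = 0"
      using disc_automorphism_isometry[OF \<tau>[of k] _ half, of 0] by simp
    then show False
      by simp
  qed
  then have bij: "bij \<tau>"
    by (simp add: bij_def finite_UNIV_inj_surj)
  define \<sigma> where "\<sigma> = inv \<tau>"
  have \<tau>\<sigma>: "\<tau> (\<sigma> j) = j" for j
    using bij by (simp add: \<sigma>_def bij_is_surj surj_f_inv_f)
  have "\<sigma> permutes UNIV"
    using bij bij_imp_bij_inv by (auto simp: \<sigma>_def intro: bij_imp_permutes)
  moreover have "disc_automorphism (\<lambda>s. F j (axis (\<sigma> j) s))" for j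
    using \<tau>[of "\<sigma> j"] by (simp add: \<tau>\<sigma>)
  moreover have "F j z = F j (axis (\<sigma> j) (z $ \<sigma> j))" if "z \<in> polydisc" for j z
    using F_\<tau>[OF that, of "\<sigma> j"] by (simp add: \<tau>\<sigma>)
  ultimately show ?thesis
    by (intro exI[of _ \<sigma>] exI[of _ "\<lambda>j s. F j (axis (\<sigma> j) s)"]) auto
qed

end
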